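(* Let $(A,\{\cdot,\cdot,\cdot\},[\cdot,\cdot,\cdot])$ be an NS-$3$-Lie algebra, and set $$[\![x,y,z]\!]=\{x,y,z\}+\{y,z,x\}+\{z,x,y\}+[x,y,z],\qquad x,y,z\in A.$$ Then $(A,[\![\cdot,\cdot,\cdot]\!])$ is a $3$-Lie algebra, denoted $A^c$. Moreover, $(A;L)$ is a representation of the $3$-Lie algebra $A^c$, where $L:\otimes^2A\to\mathfrak{gl}(A)$ is the linear map defined by $L(x,y)z=\{x,y,z\}$ for all $x,y,z\in A$.
   Context: All vector spaces are over a fixed field of characteristic different from $2$. An NS-3-Lie algebra is a vector space $A$ with two linear maps $\{\cdot,\cdot,\cdot\},[\cdot,\cdot,\cdot]:A\otimes A\otimes A\to A$, with $[\cdot,\cdot,\cdot]$ skew-symmetric, such that, with $[\![x,y,z]\!]:=\{x,y,z\}+\{y,z,x\}+\{z,x,y\}+[x,y,z]$, for all $x_1,\dots,x_5\in A$: (1) $\{x_1,x_2,x_3\}=-\{x_2,x_1,x_3\}$; (2) $\{x_1,x_2,\{x_3,x_4,x_5\}\}=\{x_3,x_4,\{x_1,x_2,x_5\}\}+\{[\![x_1,x_2,x_3]\!],x_4,x_5\}+\{x_3,[\![x_1,x_2,x_4]\!],x_5\}$; (3) $\{[\![x_1,x_2,x_3]\!],x_4,x_5\}=\{x_1,x_2,\{x_3,x_4,x_5\}\}+\{x_2,x_3,\{x_1,x_4,x_5\}\}+\{x_3,x_1,\{x_2,x_4,x_5\}\}$; (4) $[x_1,x_2,[\![x_3,x_4,x_5]\!]]=[x_3,x_4,[\![x_1,x_2,x_5]\!]]+[x_4,x_5,[\![x_1,x_2,x_3]\!]]+[x_5,x_3,[\![x_1,x_2,x_4]\!]]-\{x_1,x_2,[x_3,x_4,x_5]\}+\{x_3,x_4,[x_1,x_2,x_5]\}+\{x_4,x_5,[x_1,x_2,x_3]\}+\{x_5,x_3,[x_1,x_2,x_4]\}$.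 A 3-Lie algebra is a vector space $\mathfrak g$ with a skew-symmetric trilinear map $[\cdot,\cdot,\cdot]_{\mathfrak g}$ such that for all $x_1,\dots,x_5\in\mathfrak g$: $[x_1,x_2,[x_3,x_4,x_5]_{\mathfrak g}]_{\mathfrak g}=[[x_1,x_2,x_3]_{\mathfrak g},x_4,x_5]_{\mathfrak g}+[x_3,[x_1,x_2,x_4]_{\mathfrak g},x_5]_{\mathfrak g}+[x_3,x_4,[x_1,x_2,x_5]_{\mathfrak g}]_{\mathfrak g}$. A representation of $\mathfrak g$ is a pair $(V;\rho)$ with $V$ a vector space and $\rho:\wedge^2\mathfrak g\to\mathfrak{gl}(V)$ linear (i.e. a skew-symmetric bilinear map) such that for all $x_1,\dots,x_4\in\mathfrak g$: (i) $[\rho(x_1,x_2),\rho(x_3,x_4)]=\rho([x_1,x_2,x_3]_{\mathfrak g},x_4)+\rho(x_3,[x_1,x_2,x_4]_{\mathfrak g})$ (commutator on the left); (ii) $\rho([x_1,x_2,x_3]_{\mathfrak g},x_4)=\rho(x_1,x_2)\rho(x_3,x_4)+\rho(x_2,x_3)\rho(x_1,x_4)+\rho(x_3,x_1)\rho(x_2,x_4)$. *)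

theory Defs
  imports Complex_Main
begin

text \<open>
  Vector spaces are instances of the locale \<^locale>\<open>vector_space\<close>, with the whole type as carrier.
  A linear map out of a tensor power is encoded as the corresponding curried multilinear map.
\<close>

definition bilinear_map ::
    "('k::field \<Rightarrow> 'a::ab_group_add \<Rightarrow> 'a) \<Rightarrow> ('k \<Rightarrow> 'b::ab_group_add \<Rightarrow> 'b) \<Rightarrow> ('a \<Rightarrow> 'a \<Rightarrow> 'b) \<Rightarrow> bool"
  where "bilinear_map s1 s2 f \<longleftrightarrow>
    (\<forall>y. Vector_Spaces.linear s1 s2 (\<lambda>x. f x y)) \<and>
    (\<forall>x. Vector_Spaces.linear s1 s2 (\<lambda>y. f x y))"

definition trilinear_map ::
    "('k::field \<Rightarrow> 'a::ab_group_add \<Rightarrow> 'a) \<Rightarrow> ('k \<Rightarrow> 'b::ab_group_add \<Rightarrow> 'b) \<Rightarrow> ('a \<Rightarrow> 'a \<Rightarrow> 'a \<Rightarrow> 'b) \<Rightarrow> bool"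
  where "trilinear_map s1 s2 f \<longleftrightarrow>
    (\<forall>y z. Vector_Spaces.linear s1 s2 (\<lambda>x. f x y z)) \<and>
    (\<forall>x z. Vector_Spaces.linear s1 s2 (\<lambda>y. f x y z)) \<and>
    (\<forall>x y. Vector_Spaces.linear s1 s2 (\<lambda>z. f x y z))"

text \<open>The two adjacent transpositions generate the symmetric group on three letters.\<close>

definition skew_symmetric3 :: "('a \<Rightarrow> 'a \<Rightarrow> 'a \<Rightarrow> 'b::ab_group_add) \<Rightarrow> bool"
  where "skew_symmetric3 f \<longleftrightarrow>
    (\<forall>x y z. f y x z = - f x y z) \<and> (\<forall>x y z. f x z y = - f x y z)"

definition ns_bracket ::
    "('a::ab_group_add \<Rightarrow> 'a \<Rightarrow> 'a \<Rightarrow> 'a) \<Rightarrow> ('a \<Rightarrow> 'a \<Rightarrow> 'a \<Rightarrow> 'a) \<Rightarrow> 'a \<Rightarrow> 'a \<Rightarrow> 'a \<Rightarrow> 'a"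
  where "ns_bracket cur br x y z = cur x y z + cur y z x + cur z x y + br x y z"

text \<open>\<open>cur\<close> is the curly bracket, \<open>br\<close> the square bracket and \<open>dbl\<close> the double bracket.\<close>

locale ns_3_lie_algebra = vector_space scale
  for scale :: "'k::field \<Rightarrow> 'a::ab_group_add \<Rightarrow> 'a" +
  fixes cur br :: "'a \<Rightarrow> 'a \<Rightarrow> 'a \<Rightarrow> 'a"
    and dbl :: "'a \<Rightarrow> 'a \<Rightarrow> 'a \<Rightarrow> 'a"
  defines "dbl \<equiv> ns_bracket cur br"
  assumes cur_trilinear: "trilinear_map scale scale cur"
    and br_trilinear: "trilinear_map scale scale br"
    and br_skew: "skew_symmetric3 br"
    and cur_skew: "cur x1 x2 x3 = - cur x2 x1 x3"
    and cur_cur: "cur x1 x2 (cur x3 x4 x5) =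
          cur x3 x4 (cur x1 x2 x5) + cur (dbl x1 x2 x3) x4 x5 + cur x3 (dbl x1 x2 x4) x5"
    and cur_dbl: "cur (dbl x1 x2 x3) x4 x5 =
          cur x1 x2 (cur x3 x4 x5) + cur x2 x3 (cur x1 x4 x5) + cur x3 x1 (cur x2 x4 x5)"
    and br_dbl: "br x1 x2 (dbl x3 x4 x5) =
          br x3 x4 (dbl x1 x2 x5) + br x4 x5 (dbl x1 x2 x3) + br x5 x3 (dbl x1 x2 x4)
          - cur x1 x2 (br x3 x4 x5) + cur x3 x4 (br x1 x2 x5)
          + cur x4 x5 (br x1 x2 x3) + cur x5 x3 (br x1 x2 x4)"

locale three_lie_algebra = vector_space scale
  for scale :: "'k::field \<Rightarrow> 'g::ab_group_add \<Rightarrow> 'g" +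
  fixes bracket :: "'g \<Rightarrow> 'g \<Rightarrow> 'g \<Rightarrow> 'g"
  assumes bracket_trilinear: "trilinear_map scale scale bracket"
    and bracket_skew: "skew_symmetric3 bracket"
    and fundamental_identity: "bracket x1 x2 (bracket x3 x4 x5) =
          bracket (bracket x1 x2 x3) x4 x5 + bracket x3 (bracket x1 x2 x4) x5
          + bracket x3 x4 (bracket x1 x2 x5)"

text \<open>
  \<open>rho x y\<close> is an endomorphism of the space with scalar multiplication \<open>scaleV\<close>.  Linearity of
  \<open>rho\<close> into the space of endomorphisms, and identities between endomorphisms, are
  expressed pointwise.
\<close>

locale three_lie_representation =
  three_lie_algebra scaleG bracket + V: vector_space scaleV
  for scaleG :: "'k::field \<Rightarrow> 'g::ab_group_add \<Rightarrow> 'g"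
    and bracket :: "'g \<Rightarrow> 'g \<Rightarrow> 'g \<Rightarrow> 'g"
    and scaleV :: "'k \<Rightarrow> 'v::ab_group_add \<Rightarrow> 'v" +
  fixes rho :: "'g \<Rightarrow> 'g \<Rightarrow> 'v \<Rightarrow> 'v"
  assumes rho_endomorphism: "Vector_Spaces.linear scaleV scaleV (rho x y)"
    and rho_bilinear: "bilinear_map scaleG scaleV (\<lambda>x y. rho x y v)"
    and rho_skew: "rho x y v = - rho y x v"
    and rho_commutator: "rho x1 x2 (rho x3 x4 v) - rho x3 x4 (rho x1 x2 v) =
          rho (bracket x1 x2 x3) x4 v + rho x3 (bracket x1 x2 x4) v"
    and rho_bracket: "rho (bracket x1 x2 x3) x4 v =
          rho x1 x2 (rho x3 x4 v) + rho x2 x3 (rho x1 x4 v) + rho x3 x1 (rho x2 x4 v)"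

definition left_mult :: "('a \<Rightarrow> 'a \<Rightarrow> 'a \<Rightarrow> 'a) \<Rightarrow> 'a \<Rightarrow> 'a \<Rightarrow> ('a \<Rightarrow> 'a)"
  where "left_mult cur x y = (\<lambda>z. cur x y z)"

end

theory Submission
  imports Defs
begin

text \<open>
  Expand both sides of the fundamental identity, resolving a double bracket in the last slot of a
  curly bracket by linearity.  Axiom (2), applied to \<open>{x1, x2, {x3, x4, x5}}\<close> and its
  cyclic rotations in \<open>x3, x4, x5\<close>, and axiom (4) account for the curly brackets with a
  double bracket in the first two slots, the square brackets and the mixed terms.  The doubly nested
  curly brackets left over match by axiom (3) applied to \<open>{dbl x3 x4 x5, x1, x2}\<close> and
  \<open>{dbl x3 x4 x5, x2, x1}\<close>.  The representation axioms are (2) and (3) themselves.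
\<close>

context vector_space
begin

lemma linear_add:
  assumes "Vector_Spaces.linear scale scale f" "Vector_Spaces.linear scale scale g"
  shows "Vector_Spaces.linear scale scale (\<lambda>x. f x + g x)"
proof -
  interpret vector_space_pair scale scale ..
  show ?thesis using assms by (rule linear_compose_add)
qed

end

lemma trilinear_map_add_right:
  assumes "trilinear_map s1 s2 f"
  shows "f x y (z + w) = f x y z + f x y w"
proof -
  interpret Vector_Spaces.linear s1 s2 "f x y"
    using assms by (simp add: trilinear_map_def)
  show ?thesis by (rule add)
qed

context ns_3_lie_algebra
begin

lemma dbl_trilinear: "trilinear_map scale scale dbl"
  using cur_trilinear br_trilinear
  unfolding trilinear_map_def dbl_def ns_bracket_def
  by (auto intro!: linear_add)

text \<open>An odd permutation reverses the cyclic order of the curly terms, and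
  \<open>cur_skew\<close> turns each reversed term into minus one of the originals.\<close>

lemma dbl_skew: "skew_symmetric3 dbl"
proof -
  have swap: "br y x z = - br x y z" "br x z y = - br x y z" for x y z
    using br_skew unfolding skew_symmetric3_def by blast+
  have "dbl y x z = - dbl x y z" for x y z
    unfolding dbl_def ns_bracket_def cur_skew[of y x z] cur_skew[of x z y] cur_skew[of z y x]
      swap(1)[of x y z]
    by (simp add: algebra_simps)
  moreover have "dbl x z y = - dbl x y z" for x y z
    unfolding dbl_def ns_bracket_def cur_skew[of y x z] cur_skew[of x z y] cur_skew[of z y x]
      swap(2)[of x y z]
    by (simp add: algebra_simps)
  ultimately show ?thesis
    unfolding skew_symmetric3_def by blast
qed

lemma br_rotate: "br x y z = br z x y"
  using br_skew unfolding skew_symmetric3_def by metis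

lemma cur_dbl_right:
  "cur x y (dbl u v w) = cur x y (cur u v w) + cur x y (cur v w u)
    + cur x y (cur w u v) + cur x y (br u v w)"
  by (simp add: dbl_def ns_bracket_def trilinear_map_add_right[OF cur_trilinear])

lemma cur_minus_right: "cur x y (- z) = - cur x y z"
proof -
  interpret Vector_Spaces.linear scale scale "cur x y"
    using cur_trilinear by (simp add: trilinear_map_def)
  show ?thesis by (rule neg)
qed

lemma dbl_dbl:
  "dbl x1 x2 (dbl x3 x4 x5) =
    dbl (dbl x1 x2 x3) x4 x5 + dbl x3 (dbl x1 x2 x4) x5 + dbl x3 x4 (dbl x1 x2 x5)"
proof -
  \<comment> \<open>Serves to open only the outer bracket: the inner \<open>dbl\<close> stays folded
    so that the axioms match.\<close>
  have expand: "dbl x y z = cur x y z + cur y z x + cur z x y + br x y z" for x y z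
    by (simp add: dbl_def ns_bracket_def)
  \<comment> \<open>Skew-symmetry brings the first term into the form of axiom (3) as well; its
    minus sign is absorbed by swapping the first two inner arguments.\<close>
  have mixed: "cur x2 (dbl x3 x4 x5) x1 + cur (dbl x3 x4 x5) x1 x2 =
      cur x3 x4 (cur x2 x5 x1) + cur x3 x4 (cur x5 x1 x2)
      + cur x4 x5 (cur x2 x3 x1) + cur x4 x5 (cur x3 x1 x2)
      + cur x5 x3 (cur x2 x4 x1) + cur x5 x3 (cur x4 x1 x2)"
    using cur_skew[of x2 "dbl x3 x4 x5" x1] cur_dbl[of x3 x4 x5 x1 x2] cur_dbl[of x3 x4 x5 x2 x1]
      cur_skew[of x2 x5 x1] cur_skew[of x2 x4 x1] cur_skew[of x2 x3 x1]
    by (simp add: cur_minus_right)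
  have "dbl x1 x2 (dbl x3 x4 x5) =
      cur x1 x2 (dbl x3 x4 x5) + (cur x2 (dbl x3 x4 x5) x1 + cur (dbl x3 x4 x5) x1 x2)
      + br x1 x2 (dbl x3 x4 x5)"
    by (subst expand) (simp add: add.assoc)
  \<comment> \<open>Each term like \<open>cur x3 x4 (dbl x1 x2 x5)\<close> has three sources: axiom
    (2) gives the inner \<open>cur x1 x2 x5\<close>, \<open>mixed\<close> its two rotations, and
    axiom (4) the inner \<open>br x1 x2 x5\<close>. The terms \<open>cur x1 x2 (br x3 x4 x5)\<close>
    cancel.\<close>
  also have "\<dots> =
      (cur (dbl x1 x2 x3) x4 x5 + cur x4 x5 (dbl x1 x2 x3) + cur x5 (dbl x1 x2 x3) x4
        + br x4 x5 (dbl x1 x2 x3))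
      + (cur x3 (dbl x1 x2 x4) x5 + cur (dbl x1 x2 x4) x5 x3 + cur x5 x3 (dbl x1 x2 x4)
        + br x5 x3 (dbl x1 x2 x4))
      + (cur x3 x4 (dbl x1 x2 x5) + cur x4 (dbl x1 x2 x5) x3 + cur (dbl x1 x2 x5) x3 x4
        + br x3 x4 (dbl x1 x2 x5))"
    unfolding mixed cur_dbl_right br_dbl[of x1 x2 x3 x4 x5]
      cur_cur[of x1 x2 x3 x4 x5] cur_cur[of x1 x2 x4 x5 x3] cur_cur[of x1 x2 x5 x3 x4]
    by (simp add: algebra_simps)
  \<comment> \<open>Axiom (4) leaves the double bracket in the last slot of \<open>br\<close>;
    \<open>br_rotate\<close> aligns it with its slot in the outer \<open>dbl\<close>.\<close>
  also have "\<dots> =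
      dbl (dbl x1 x2 x3) x4 x5 + dbl x3 (dbl x1 x2 x4) x5 + dbl x3 x4 (dbl x1 x2 x5)"
    using expand[of "dbl x1 x2 x3" x4 x5] expand[of x3 "dbl x1 x2 x4" x5]
      expand[of x3 x4 "dbl x1 x2 x5"] br_rotate[of "dbl x1 x2 x3" x4 x5]
      br_rotate[of x4 x5 "dbl x1 x2 x3"] br_rotate[of x3 "dbl x1 x2 x4" x5]
    by (simp add: algebra_simps)
  finally show ?thesis .
qed

lemma three_lie_algebra_dbl: "three_lie_algebra scale dbl"
  by unfold_locales (rule dbl_trilinear dbl_skew dbl_dbl)+

lemma three_lie_representation_left_mult:
  "three_lie_representation scale dbl scale (left_mult cur)"
proof (rule three_lie_representation.intro[OF three_lie_algebra_dbl vector_space_axioms])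
  show "three_lie_representation_axioms scale dbl scale (left_mult cur)"
  proof (rule three_lie_representation_axioms.intro)
    fix x y v
    \<comment> \<open>The last slot of \<open>cur\<close> gives the endomorphism, the first two give
      bilinearity.\<close>
    show "Vector_Spaces.linear scale scale (left_mult cur x y)"
      and "bilinear_map scale scale (\<lambda>x y. left_mult cur x y v)"
      using cur_trilinear by (auto simp: trilinear_map_def bilinear_map_def left_mult_def)
    show "left_mult cur x y v = - left_mult cur y x v"
      unfolding left_mult_def by (rule cur_skew)
  next
    fix x1 x2 x3 x4 v
    show "left_mult cur x1 x2 (left_mult cur x3 x4 v) - left_mult cur x3 x4 (left_mult cur x1 x2 v)
        = left_mult cur (dbl x1 x2 x3) x4 v + left_mult cur x3 (dbl x1 x2 x4) v"
      using cur_cur[of x1 x2 x3 x4 v] by (simp add: left_mult_def)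
    show "left_mult cur (dbl x1 x2 x3) x4 v = left_mult cur x1 x2 (left_mult cur x3 x4 v)
        + left_mult cur x2 x3 (left_mult cur x1 x4 v) + left_mult cur x3 x1 (left_mult cur x2 x4 v)"
      unfolding left_mult_def by (rule cur_dbl)
  qed
qed

end

theorem theorem3p3:
  fixes scale :: "'k::field \<Rightarrow> 'a::ab_group_add \<Rightarrow> 'a"
    and cur br :: "'a \<Rightarrow> 'a \<Rightarrow> 'a \<Rightarrow> 'a"
  assumes "CHAR('k) \<noteq> 2"
    and "ns_3_lie_algebra scale cur br"
  shows "three_lie_algebra scale (ns_bracket cur br) \<and>
    three_lie_representation scale (ns_bracket cur br) scale (left_mult cur)"
  using ns_3_lie_algebra.three_lie_algebra_dbl[OF assms(2)]
    ns_3_lie_algebra.three_lie_representation_left_mult[OF assms(2)]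
  by blast

end
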